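(* Let $G$ be a separable metrizable almost torsion-free paratopological abelian group with $|G|=\mathfrak{c}$. Then $G$ is $d$-independent.
   Context: $\mathfrak{c}=|\mathbb{R}|$; $e$ is the neutral element (additive notation). A paratopological group is a group with a topology for which the group operation is jointly continuous. An abelian group $G$ is almost torsion-free if $G[n]=\{g\in G: ng=e\}$ is finite for each positive integer $n$. A nontrivial paratopological group $G$ is $d$-independent if for every subgroup $S$ of $G$ with $|S|<\mathfrak{c}$ there is a countable dense subgroup $H$ of $G$ with $S\cap H=\{e\}$. *)

theory Defs
  imports "HOL-Analysis.Analysis" "HOL-Algebra.Group"
begin

text \<open>
  Groups are HOL-Algebra groups, hence written multiplicatively also when commutative:
  \<open>x [^] n\<close> stands for the multiple \<open>n x\<close>, and \<open>\<one>\<close> for the neutral element \<open>e\<close>.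
  No separation axiom is part of the notion of a paratopological group.
\<close>

locale paratopological_group = group G for G (structure) +
  fixes T :: "'a topology"
  assumes topspace_eq_carrier: "topspace T = carrier G"
    and continuous_mult: "continuous_map (prod_topology T T) T (\<lambda>(x, y). x \<otimes> y)"

definition n_torsion :: "('a, 'b) monoid_scheme \<Rightarrow> nat \<Rightarrow> 'a set" where
  "n_torsion G n = {g \<in> carrier G. g [^]\<^bsub>G\<^esub> n = \<one>\<^bsub>G\<^esub>}"

definition almost_torsion_free :: "('a, 'b) monoid_scheme \<Rightarrow> bool" where
  "almost_torsion_free G \<longleftrightarrow> (\<forall>n::nat. n > 0 \<longrightarrow> finite (n_torsion G n))"

definition d_independent :: "('a, 'b) monoid_scheme \<Rightarrow> 'a topology \<Rightarrow> bool" where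
  "d_independent G T \<longleftrightarrow>
     carrier G \<noteq> {\<one>\<^bsub>G\<^esub>} \<and>
     (\<forall>S. subgroup S G \<and> S \<prec> (UNIV :: real set) \<longrightarrow>
       (\<exists>H. subgroup H G \<and> countable H \<and> T closure_of H = topspace T \<and>
            S \<inter> H = {\<one>\<^bsub>G\<^esub>}))"

end

theory Submission
  imports Defs "HOL-Algebra.Generated_Groups"
begin

text \<open>
  Call a set small if it embeds into \<open>S \<times> \<nat>\<close>, where \<open>S\<close> is the given subgroup with \<open>|S| < \<cc>\<close>.
  Small sets are closed under countable unions, and since \<open>S \<times> \<nat>\<close> is countable or of the size of
  \<open>S\<close>, the reals are not small (\<open>times_nat_lesspoll_reals\<close>). Two consequences drive the proof.

  On the topological side, \<open>G\<close> is second countable, hence Lindelof, so it is covered by countably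
  many translates of any nonempty open set; as \<open>G\<close> has size \<open>\<cc>\<close>, no nonempty open set is small
  (\<open>carrier_lepoll_if_open_lepoll\<close>). On the algebraic side, let \<open>H\<close> be a countable subgroup. Then
  \<open>SH\<close> is small, and almost torsion-freeness makes every map \<open>x \<mapsto> x\<^sup>n\<close> with \<open>n > 0\<close>
  finite-to-one, so the elements with some positive power in \<open>SH\<close> form a small set as well
  (\<open>roots_lepoll\<close>). Every nonempty open set therefore contains an \<open>x\<close> none of whose positive powers
  lies in \<open>SH\<close>; adjoining such an \<open>x\<close> to \<open>H\<close> keeps the intersection with \<open>S\<close> trivial
  (\<open>adjoin_independent\<close>).

  Starting with the trivial subgroup and treating the members of a countable base one after the
  other gives an increasing sequence of countable subgroups. Its union is countable, meets every
  nonempty open set and intersects \<open>S\<close> trivially.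
\<close>

section \<open>Cardinality\<close>

lemma lepoll_iff_card_of_ordLeq: "A \<lesssim> B \<longleftrightarrow> ordLeq2 (card_of A) (card_of B)"
  unfolding lepoll_def using card_of_ordLeq by blast

lemma countable_UN_lepoll:
  assumes "infinite K" "countable I" "\<And>i. i \<in> I \<Longrightarrow> F i \<lesssim> K"
  shows "(\<Union>i\<in>I. F i) \<lesssim> K"
proof -
  have "I \<lesssim> (UNIV :: nat set)"
    using assms(2) unfolding countable_def lepoll_def by blast
  with assms(1) have "I \<lesssim> K"
    using infinite_le_lepoll lepoll_trans by blast
  with assms show ?thesis
    unfolding lepoll_iff_card_of_ordLeq by (intro card_of_UNION_ordLeq_infinite) auto
qed

lemma countable_fibres_lepoll:
  assumes K: "infinite K" and M: "M \<lesssim> K"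
    and f: "\<And>x. x \<in> A \<Longrightarrow> f x \<in> M"
    and fib: "\<And>y. y \<in> M \<Longrightarrow> countable {x \<in> A. f x = y}"
  shows "A \<lesssim> K"
proof -
  have "{x \<in> A. f x = y} \<lesssim> K" if "y \<in> M" for y
    using fib[OF that] K
    by (metis countable_def infinite_le_lepoll lepoll_def lepoll_trans subset_UNIV)
  then have "(\<Union>y\<in>M. {x \<in> A. f x = y}) \<lesssim> K"
    using K M unfolding lepoll_iff_card_of_ordLeq
    by (intro card_of_UNION_ordLeq_infinite) auto
  moreover have "A = (\<Union>y\<in>M. {x \<in> A. f x = y})"
    using f by auto
  ultimately show ?thesis
    by simp
qed

lemma times_nat_lesspoll_reals:
  assumes "S \<prec> (UNIV :: real set)"
  shows "S \<times> (UNIV :: nat set) \<prec> (UNIV :: real set)"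
proof (cases "finite S")
  case True
  then have c: "countable (S \<times> (UNIV :: nat set))"
    by (simp add: countable_finite)
  then have "S \<times> (UNIV :: nat set) \<lesssim> (UNIV :: nat set)"
    unfolding countable_def lepoll_def by blast
  moreover have "(UNIV :: nat set) \<lesssim> (UNIV :: real set)"
    using infinite_UNIV_char_0 infinite_le_lepoll by blast
  moreover have "\<not> S \<times> (UNIV :: nat set) \<approx> (UNIV :: real set)"
    using c uncountable_UNIV_real countable_eqpoll eqpoll_sym by blast
  ultimately show ?thesis
    unfolding lesspoll_def using lepoll_trans by blast
next
  case False
  then have "(UNIV :: nat set) \<lesssim> S"
    by (simp add: infinite_le_lepoll)
  then have "S \<times> (UNIV :: nat set) \<approx> S"
    unfolding eqpoll_iff_card_of_ordIso lepoll_iff_card_of_ordLeq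
    using False card_of_Times_infinite_simps(1) by blast
  then show ?thesis
    using assms eq_lesspoll_trans by blast
qed

section \<open>Open sets of a paratopological group\<close>

text \<open>The balls of radius \<open>1 / Suc n\<close> around the points of a countable dense set form a base.\<close>

lemma separable_metrizable_imp_second_countable:
  assumes "separable_space X" "metrizable_space X"
  shows "second_countable X"
proof -
  obtain M d where "Metric_space M d" and X: "X = Metric_space.mtopology M d"
    using assms(2) unfolding metrizable_space_def by blast
  interpret Metric_space M d
    by fact
  obtain D where D: "countable D" "D \<subseteq> M" "X closure_of D = M"
    using assms(1) unfolding separable_space_def X by auto
  define B where "B = (\<lambda>(x, n). mball x (1 / real (Suc n))) ` (D \<times> (UNIV :: nat set))"
  have "countable B"
    unfolding B_def using D(1) by auto
  moreover have "openin X V" if "V \<in> B" for V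
    using that unfolding B_def X by auto
  moreover have "\<exists>V\<in>B. x \<in> V \<and> V \<subseteq> U" if "openin X U" "x \<in> U" for U x
  proof -
    from that obtain r where r: "r > 0" "mball x r \<subseteq> U" and xM: "x \<in> M"
      unfolding X openin_mtopology by blast
    obtain n where n: "1 / real (Suc n) < r / 2"
      using reals_Archimedean[of "r / 2"] r(1) by (auto simp: inverse_eq_divide)
    obtain y where y: "y \<in> D" "y \<in> mball x (1 / real (Suc n))"
    proof -
      have "x \<in> mtopology closure_of D"
        using D(3) xM by (simp add: X)
      then have "\<forall>r>0. \<exists>y\<in>D. y \<in> mball x r"
        unfolding metric_closure_of by blast
      then show ?thesis
        using that by (meson divide_pos_pos of_nat_0_less_iff zero_less_Suc zero_less_one)
    qed
    have "x \<in> mball y (1 / real (Suc n))"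
      using y(2) by (simp add: commute)
    moreover have "mball y (1 / real (Suc n)) \<subseteq> mball x r"
    proof
      fix z assume z: "z \<in> mball y (1 / real (Suc n))"
      have "d x z \<le> d x y + d y z"
        using y z by (intro triangle) auto
      with y z n show "z \<in> mball x r"
        by auto
    qed
    ultimately show ?thesis
      using r(2) y(1) unfolding B_def by blast
  qed
  ultimately show ?thesis
    unfolding second_countable_def by blast
qed

context paratopological_group
begin

text \<open>
  The translate \<open>aU\<close> is written as a preimage because the maps \<open>x \<mapsto> a\<^sup>-\<^sup>1 x\<close> are continuous.
\<close>

lemma openin_translate:
  assumes "openin T U" "a \<in> carrier G"
  shows "openin T {x \<in> carrier G. inv a \<otimes> x \<in> U}"
proof -
  have "continuous_map T (prod_topology T T) (\<lambda>x. (inv a, x))"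
    using assms(2) by (intro continuous_map_pairedI) (auto simp: topspace_eq_carrier)
  then have "continuous_map T T ((\<lambda>(x, y). x \<otimes> y) \<circ> (\<lambda>x. (inv a, x)))"
    using continuous_mult by (rule continuous_map_compose)
  then have "continuous_map T T (\<lambda>x. inv a \<otimes> x)"
    by (simp add: comp_def)
  from openin_continuous_map_preimage[OF this assms(1)] show ?thesis
    by (simp add: topspace_eq_carrier)
qed

lemma carrier_lepoll_if_open_lepoll:
  assumes "Lindelof_space T" "openin T U" "U \<noteq> {}" "infinite K" "U \<lesssim> K"
  shows "carrier G \<lesssim> K"
proof -
  define F where "F a = {x \<in> carrier G. inv a \<otimes> x \<in> U}" for a
  obtain u where u: "u \<in> U" "u \<in> carrier G"
    using assms(2,3) openin_subset topspace_eq_carrier by blast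
  have "x \<in> F (x \<otimes> inv u)" if "x \<in> carrier G" for x
    using that u by (simp add: F_def inv_mult_group m_assoc)
  then have "\<Union>(F ` carrier G) = topspace T"
    using u unfolding topspace_eq_carrier F_def by fastforce
  moreover have "\<forall>V \<in> F ` carrier G. openin T V"
    using openin_translate[OF assms(2)] by (auto simp: F_def)
  ultimately obtain \<V> where "countable \<V>" "\<V> \<subseteq> F ` carrier G" and cover: "\<Union>\<V> = carrier G"
    using assms(1)[unfolded Lindelof_space_def, rule_format, of "F ` carrier G"]
    unfolding topspace_eq_carrier by metis
  moreover have "F a \<lesssim> K" if "a \<in> carrier G" for a
  proof -
    have "inj_on (\<lambda>x. inv a \<otimes> x) (F a)"
      using that by (intro inj_onI) (auto simp: F_def)
    moreover have "(\<lambda>x. inv a \<otimes> x) ` F a \<subseteq> U"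
      by (auto simp: F_def)
    ultimately have "F a \<lesssim> U"
      unfolding lepoll_def by blast
    then show ?thesis
      using assms(5) lepoll_trans by blast
  qed
  ultimately have "(\<Union>V\<in>\<V>. V) \<lesssim> K"
    using assms(4) by (intro countable_UN_lepoll) auto
  then show ?thesis
    using cover by simp
qed

end

section \<open>Independent elements of an almost torsion-free group\<close>

context comm_group
begin

text \<open>Each fibre of \<open>x \<mapsto> x\<^sup>n\<close> is empty or a translate of the \<open>n\<close>-torsion subgroup.\<close>

lemma finite_roots:
  assumes "almost_torsion_free G" "n > (0::nat)"
  shows "finite {x \<in> carrier G. x [^] n = y}"
proof (cases "\<exists>a \<in> carrier G. a [^] n = y")
  case True
  then obtain a where a: "a \<in> carrier G" "a [^] n = y"
    by blast
  have "{x \<in> carrier G. x [^] n = y} \<subseteq> (\<lambda>t. t \<otimes> a) ` n_torsion G n"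
  proof
    fix x assume "x \<in> {x \<in> carrier G. x [^] n = y}"
    then have x: "x \<in> carrier G" "x [^] n = y"
      by auto
    have "(x \<otimes> inv a) [^] n = \<one>"
      using a x by (metis inv_closed nat_pow_closed nat_pow_distrib nat_pow_inv r_inv)
    then have "x \<otimes> inv a \<in> n_torsion G n"
      using a x by (simp add: n_torsion_def)
    moreover have "x = (x \<otimes> inv a) \<otimes> a"
      using a x by (simp add: m_assoc)
    ultimately show "x \<in> (\<lambda>t. t \<otimes> a) ` n_torsion G n"
      by blast
  qed
  moreover have "finite (n_torsion G n)"
    using assms unfolding almost_torsion_free_def by blast
  ultimately show ?thesis
    using finite_surj by blast
next
  case False
  then have "{x \<in> carrier G. x [^] n = y} = {}"
    by blast
  then show ?thesis
    by (simp only: finite.emptyI)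
qed

lemma roots_lepoll:
  assumes atf: "almost_torsion_free G" and K: "infinite K" "M \<lesssim> K"
  shows "{x \<in> carrier G. \<exists>n>0::nat. x [^] n \<in> M} \<lesssim> K"
proof -
  have "{x \<in> carrier G. x [^] n \<in> M} \<lesssim> K" if "n > 0" for n :: nat
  proof (rule countable_fibres_lepoll[OF K, where f = "\<lambda>x. x [^] n"])
    fix y
    have "finite {x \<in> {x \<in> carrier G. x [^] n \<in> M}. x [^] n = y}"
      by (rule finite_subset[OF _ finite_roots[OF atf that, of y]]) auto
    then show "countable {x \<in> {x \<in> carrier G. x [^] n \<in> M}. x [^] n = y}"
      by (rule countable_finite)
  qed auto
  then have "(\<Union>n\<in>{0::nat<..}. {x \<in> carrier G. x [^] n \<in> M}) \<lesssim> K"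
    using K(1) by (intro countable_UN_lepoll) auto
  moreover have "{x \<in> carrier G. \<exists>n>0::nat. x [^] n \<in> M}
      = (\<Union>n\<in>{0::nat<..}. {x \<in> carrier G. x [^] n \<in> M})"
    by auto
  ultimately show ?thesis
    by simp
qed

text \<open>
  An element \<open>h x\<^sup>k\<close> of the enlarged subgroup that lies in \<open>S\<close> puts \<open>x\<^sup>k\<close>, hence also \<open>x\<^sup>|\<^sup>k\<^sup>|\<close>,
  into \<open>SH\<close>. So \<open>k = 0\<close>, and the element is in \<open>S \<inter> H\<close>.
\<close>

lemma adjoin_independent:
  assumes S: "subgroup S G" and H: "subgroup H G" "S \<inter> H = {\<one>}"
    and x: "x \<in> carrier G" "\<And>n::nat. n > 0 \<Longrightarrow> x [^] n \<notin> S <#> H"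
  shows "S \<inter> (H <#> generate G {x}) = {\<one>}"
proof -
  have SH: "subgroup (S <#> H) G"
    using S H(1) by (rule mult_subgroups)
  have "g = \<one>" if g: "g \<in> S" "g \<in> H <#> generate G {x}" for g
  proof -
    obtain h k where h: "h \<in> H" and gh: "g = h \<otimes> x [^] (k :: int)"
      using g(2) x(1) by (auto simp: set_mult_def generate_pow)
    have hc: "h \<in> carrier G" "g \<in> carrier G"
      using subgroup.mem_carrier[OF H(1) h] subgroup.mem_carrier[OF S g(1)] by simp_all
    have "x [^] k = g \<otimes> inv h"
      using gh hc x(1) by (simp add: m_comm[of h] m_assoc)
    then have xk: "x [^] k \<in> S <#> H"
      using g(1) subgroup.m_inv_closed[OF H(1) h] by (auto simp: set_mult_def)
    have "k = 0"
    proof (rule ccontr)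
      assume "k \<noteq> 0"
      have "x [^] (int (nat \<bar>k\<bar>)) \<in> S <#> H"
        using xk x(1) subgroup.m_inv_closed[OF SH xk] by (cases "k \<ge> 0") (auto simp: int_pow_neg)
      then have "x [^] nat \<bar>k\<bar> \<in> S <#> H"
        by (simp only: int_pow_int)
      with x(2)[of "nat \<bar>k\<bar>"] \<open>k \<noteq> 0\<close> show False
        by simp
    qed
    then have "g = h"
      using gh hc by simp
    with g(1) h H(2) show ?thesis
      by auto
  qed
  moreover have "\<one> \<in> H <#> generate G {x}"
    using H(1) x(1) by (intro subgroup.one_closed mult_subgroups generate_is_subgroup) auto
  ultimately show ?thesis
    using subgroup.one_closed[OF S] by blast
qed

lemma subgroup_UN_increasing:
  assumes H: "\<And>n::nat. subgroup (H n) G" "\<And>n. H n \<subseteq> H (Suc n)"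
  shows "subgroup (\<Union>n. H n) G"
proof (rule subgroupI)
  fix a b assume "a \<in> (\<Union>n. H n)" "b \<in> (\<Union>n. H n)"
  then obtain m n where "a \<in> H m" "b \<in> H n"
    by blast
  then have "a \<in> H (max m n)" "b \<in> H (max m n)"
    using lift_Suc_mono_le[of H, OF H(2)] by (meson max.cobounded1 max.cobounded2 subsetD)+
  then show "a \<otimes> b \<in> (\<Union>n. H n)"
    using H(1) subgroup.m_closed by fastforce
qed (use H(1) in \<open>auto dest: subgroup.mem_carrier subgroup.one_closed subgroup.m_inv_closed\<close>)

end

section \<open>Countable dense subgroups avoiding a small subgroup\<close>

text \<open>
  The elements with a positive power in \<open>SH\<close> form a set that embeds into \<open>S \<times> \<nat>\<close>, and \<open>U\<close> does
  not embed there; so \<open>U\<close> contains an element that can be adjoined to \<open>H\<close>.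
\<close>

lemma enlarge_into_open:
  fixes G (structure)
  assumes G: "paratopological_group G T" "comm_group G" "Lindelof_space T"
    and atf: "almost_torsion_free G" and card: "carrier G \<approx> (UNIV :: real set)"
    and S: "subgroup S G" "S \<prec> (UNIV :: real set)"
    and H: "subgroup H G" "countable H" "S \<inter> H = {\<one>}"
    and U: "openin T U" "U \<noteq> {}"
  shows "\<exists>H'. subgroup H' G \<and> countable H' \<and> S \<inter> H' = {\<one>} \<and> H \<subseteq> H' \<and> H' \<inter> U \<noteq> {}"
proof -
  interpret paratopological_group G T by fact
  interpret comm_group G by fact
  let ?K = "S \<times> (UNIV :: nat set)"
  let ?roots = "{x \<in> carrier G. \<exists>n>0::nat. x [^] n \<in> S <#> H}"
  have K: "infinite ?K"
    using subgroup.one_closed[OF S(1)] by (auto simp: finite_cartesian_product_iff)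
  have "S <#> H \<lesssim> S \<times> H"
  proof -
    have "S <#> H = (\<lambda>(s, h). s \<otimes> h) ` (S \<times> H)"
      by (auto simp: set_mult_def)
    then show ?thesis
      by (simp only: image_lepoll)
  qed
  also have "S \<times> H \<lesssim> ?K"
    using H(2) by (intro times_lepoll_mono) (auto simp: countable_def lepoll_def)
  finally have "?roots \<lesssim> ?K"
    using roots_lepoll[OF atf K] by blast
  moreover have "\<not> U \<lesssim> ?K"
  proof
    assume "U \<lesssim> ?K"
    then have "carrier G \<lesssim> ?K"
      using carrier_lepoll_if_open_lepoll[OF G(3) U K] by blast
    with times_nat_lesspoll_reals[OF S(2)] have "carrier G \<prec> (UNIV :: real set)"
      by (rule lesspoll_trans1[rotated])
    with card show False
      by (simp add: lesspoll_def)
  qed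
  ultimately have "\<not> U \<subseteq> ?roots"
    using subset_imp_lepoll lepoll_trans by blast
  then obtain x where x: "x \<in> U" "x \<in> carrier G" "\<And>n::nat. n > 0 \<Longrightarrow> x [^] n \<notin> S <#> H"
    using openin_subset[OF U(1)] topspace_eq_carrier by blast
  let ?H' = "H <#> generate G {x}"
  have gen: "subgroup (generate G {x}) G" and xgen: "x \<in> generate G {x}"
    using x(2) by (auto intro: generate_is_subgroup generate.incl)
  have Hc: "h \<in> carrier G" if "h \<in> H" for h
    using subgroup.mem_carrier[OF H(1) that] .
  have "h \<in> ?H'" if "h \<in> H" for h
    using that subgroup.one_closed[OF gen] Hc[OF that] by (force simp: set_mult_def)
  moreover have "x \<in> ?H'"
    using xgen subgroup.one_closed[OF H(1)] x(2) by (force simp: set_mult_def)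
  moreover have "countable ?H'"
  proof -
    have "generate G {x} = range (\<lambda>k::int. x [^] k)"
      using x(2) by (auto simp: generate_pow)
    then show ?thesis
      using H(2) by (auto simp: set_mult_def)
  qed
  ultimately show ?thesis
    using mult_subgroups[OF H(1) gen] adjoin_independent[OF S(1) H(1,3) x(2,3)] x(1)
    by (intro exI[of _ ?H']) auto
qed

theorem corollary4p26:
  fixes G :: "('a, 'b) monoid_scheme" and T :: "'a topology"
  assumes "paratopological_group G T"
    and "comm_group G"
    and "separable_space T"
    and "metrizable_space T"
    and "almost_torsion_free G"
    and "carrier G \<approx> (UNIV :: real set)"
  shows "d_independent G T"
proof -
  interpret paratopological_group G T by fact
  interpret comm_group G by fact
  have second_countable: "second_countable T"
    using assms(3,4) by (rule separable_metrizable_imp_second_countable)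
  then have Lindelof: "Lindelof_space T"
    by (rule second_countable_imp_Lindelof_space)
  obtain \<B> where \<B>: "countable \<B>" "\<forall>V\<in>\<B>. openin T V"
    and base: "\<forall>U x. openin T U \<and> x \<in> U \<longrightarrow> (\<exists>V\<in>\<B>. x \<in> V \<and> V \<subseteq> U)"
    using second_countable unfolding second_countable_def by (elim exE conjE)
  have "\<exists>H. subgroup H G \<and> countable H \<and> T closure_of H = topspace T \<and> S \<inter> H = {\<one>\<^bsub>G\<^esub>}"
    if S: "subgroup S G" "S \<prec> (UNIV :: real set)" for S
  proof -
    define good where "good H \<longleftrightarrow> subgroup H G \<and> countable H \<and> S \<inter> H = {\<one>\<^bsub>G\<^esub>}" for H
    (* The guard: the base may contain the empty set, which no subgroup meets, and
       from_nat_into yields an arbitrary set when applied to an empty family. *)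
    define next_stage where "next_stage n H H' \<longleftrightarrow> H \<subseteq> H' \<and>
      (from_nat_into \<B> n \<in> \<B> \<and> from_nat_into \<B> n \<noteq> {} \<longrightarrow> H' \<inter> from_nat_into \<B> n \<noteq> {})" for n H H'
    have "\<exists>H. good H"
      using triv_subgroup subgroup.one_closed[OF S(1)] unfolding good_def
      by (intro exI[of _ "{\<one>\<^bsub>G\<^esub>}"]) auto
    moreover have "\<exists>H'. good H' \<and> next_stage n H H'" if "good H" for n H
    proof (cases "from_nat_into \<B> n \<in> \<B> \<and> from_nat_into \<B> n \<noteq> {}")
      case True
      with that \<B>(2) show ?thesis
        using enlarge_into_open[OF assms(1,2) Lindelof assms(5,6) S, of H "from_nat_into \<B> n"]
        unfolding good_def next_stage_def by blast
    next
      case False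
      with that show ?thesis
        unfolding next_stage_def by blast
    qed
    ultimately obtain H where good: "\<And>n. good (H n)" and nxt: "\<And>n. next_stage n (H n) (H (Suc n))"
      using dependent_nat_choice[of "\<lambda>_. good" next_stage] by blast
    have "subgroup (\<Union>n. H n) G"
      using good nxt by (intro subgroup_UN_increasing) (auto simp: good_def next_stage_def)
    moreover have "countable (\<Union>n. H n)"
      using good by (auto simp: good_def)
    moreover have "T closure_of (\<Union>n. H n) = topspace T"
      unfolding dense_intersects_open
    proof (intro allI impI)
      fix U assume "openin T U \<and> U \<noteq> {}"
      then obtain V where V: "V \<in> \<B>" "V \<noteq> {}" "V \<subseteq> U"
        using base by blast
      then obtain n where "from_nat_into \<B> n = V"
        using from_nat_into_surj[OF \<B>(1)] by blast
      then have "H (Suc n) \<inter> V \<noteq> {}"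
        using nxt[of n] V unfolding next_stage_def by blast
      with V(3) show "(\<Union>n. H n) \<inter> U \<noteq> {}"
        by blast
    qed
    moreover have "S \<inter> (\<Union>n. H n) = {\<one>\<^bsub>G\<^esub>}"
      using good unfolding good_def by blast
    ultimately show ?thesis
      by blast
  qed
  moreover have "carrier G \<noteq> {\<one>\<^bsub>G\<^esub>}"
  proof
    assume "carrier G = {\<one>\<^bsub>G\<^esub>}"
    then have "finite (UNIV :: real set)"
      using eqpoll_finite_iff[OF assms(6)] by simp
    then show False
      by (simp add: infinite_UNIV_char_0)
  qed
  ultimately show ?thesis
    by (simp add: d_independent_def)
qed

end
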